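(* Let $d\ge 1$ and $n\ge 2$ be integers and let $\gamma>0$. For a sample $Q_n=\{z_i\}_{i=1}^n$ of points $z_i\in\mathbb{R}^d$, the expectations in the definition of $\mathrm{MMD}_u^2(\mathcal{N}_d,Q_n)$ can be computed analytically, giving $$\mathrm{MMD}_{u}^{2}(\mathcal{N}_{d},Q_{n})=\left(\frac{\gamma^{2}}{2+\gamma^{2}}\right)^{d/2}-\frac{2}{n}\left(\frac{\gamma^{2}}{1+\gamma^{2}}\right)^{d/2}\sum_{i=1}^{n}e^{-\frac{\Vert z_{i}\Vert^{2}}{2(1+\gamma^{2})}}+\frac{1}{n(n-1)}\sum_{i=1}^{n}\sum_{\substack{j=1\\ j\neq i}}^{n}e^{-\frac{\Vert z_{i}-z_{j}\Vert^{2}}{2\gamma^{2}}}.$$ In addition, under the null $Q=P=\mathcal{N}_d$, i.e. when $z_1,\dots,z_n$ are i.i.d. random vectors with distribution $\mathcal{N}_d$, the variance of this estimator is $$\mathrm{Var}_{Q_{n}\sim\mathcal{N}_{d}}\left[\mathrm{MMD}_{u}^{2}(\mathcal{N}_{d},Q_{n})\right]=\frac{2}{n(n-1)}\left[\left(\frac{\gamma^{2}}{2+\gamma^{2}}\right)^{d}+\left(\frac{\gamma^{2}}{4+\gamma^{2}}\right)^{d/2}-2\left(\frac{\gamma^{4}}{(1+\gamma^{2})(3+\gamma^{2})}\right)^{d/2}\right].$$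
   Context: $\Vert\cdot\Vert$ is the Euclidean ($\ell_2$) norm on $\mathbb{R}^d$. $\mathcal{N}_d$ denotes the standard multivariate normal distribution on $\mathbb{R}^d$, with density $p(x)=(2\pi)^{-d/2}e^{-\Vert x\Vert^2/2}$. The kernel is the Gaussian RBF kernel of width $\gamma>0$: $k(x,y)=e^{-\Vert x-y\Vert^{2}/(2\gamma^{2})}$ for $x,y\in\mathbb{R}^d$. For a sample $Q_n=\{z_i\}_{i=1}^n\subset\mathbb{R}^d$ of size $n$ (from a distribution $Q$), the unbiased estimator of the squared maximum mean discrepancy between $P=\mathcal{N}_d$ and $Q$ is defined by $$\mathrm{MMD}_{u}^{2}(\mathcal{N}_{d},Q_{n})=\mathbb{E}_{x,x'\sim\mathcal{N}_{d}}[k(x,x')]-\frac{2}{n}\sum_{i=1}^{n}\mathbb{E}_{x\sim\mathcal{N}_{d}}[k(x,z_{i})]+\frac{1}{n(n-1)}\sum_{i=1}^{n}\sum_{\substack{j=1\\ j\neq i}}^{n}k(z_{i},z_{j}),$$ where $x,x'$ are independent in the first term and the expectations are over $x,x'$ only (the $z_i$ being held fixed). *)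

theory Defs
  imports "HOL-Probability.Probability"
begin

definition std_normal_vec :: "(real ^ 'd) measure" where
  "std_normal_vec =
     density lborel (\<lambda>x. ennreal ((2 * pi) powr (- (real CARD('d) / 2)) * exp (- (norm x)\<^sup>2 / 2)))"

definition rbf_kernel :: "real \<Rightarrow> real ^ 'd \<Rightarrow> real ^ 'd \<Rightarrow> real" where
  "rbf_kernel \<gamma> x y = exp (- (norm (x - y))\<^sup>2 / (2 * \<gamma>\<^sup>2))"

text \<open>The sample is \<open>z 1, \<dots>, z n\<close>; values of \<open>z\<close> outside \<open>{1..n}\<close> are not used. The product
  measure in the first term encodes the independence of the two draws from \<open>P\<close>.\<close>

definition mmd_u_sq :: "real \<Rightarrow> (real ^ 'd) measure \<Rightarrow> nat \<Rightarrow> (nat \<Rightarrow> real ^ 'd) \<Rightarrow> real" where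
  "mmd_u_sq \<gamma> P n z =
     (\<integral>(x, x'). rbf_kernel \<gamma> x x' \<partial>(P \<Otimes>\<^sub>M P))
     - 2 / real n * (\<Sum>i\<in>{1..n}. \<integral>x. rbf_kernel \<gamma> x (z i) \<partial>P)
     + 1 / (real n * (real n - 1)) * (\<Sum>i\<in>{1..n}. \<Sum>j\<in>{1..n} - {i}. rbf_kernel \<gamma> (z i) (z j))"

end

(* Writing mu(x) = E k(x, X) and c = E k(X, X'), the estimator equals the U-statistic
   1/(n(n-1)) * sum over i \<noteq> j of h(z_i, z_j) with h(x, y) = k(x, y) - mu(x) - mu(y) + c.
   Under the null this h is degenerate, i.e. E h(X, y) = 0 for every y, so the summands for (i, j) and
   (k, l) are uncorrelated unless {i, j} = {k, l}, and the variance is 2/(n(n-1)) E h^2.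
   By degeneracy E h^2 = E k^2 - 2 E mu^2 + c^2, and each term is a Gaussian integral, evaluated by
   completing the square. *)
theory Submission
  imports Defs
begin

section \<open>Gaussian integrals\<close>

text \<open>The norm square is a sum over coordinates, so the isotropic Gaussian density factorises;
  normalisation in any dimension thus reduces to the one-dimensional case.\<close>

lemma prod_normal_density:
  fixes m x :: "'a::euclidean_space"
  assumes "\<sigma> > 0"
  shows "(\<Prod>b\<in>Basis. normal_density (m \<bullet> b) \<sigma> (x \<bullet> b))
    = (2 * pi * \<sigma>\<^sup>2) powr (- (real DIM('a) / 2)) * exp (- (norm (x - m))\<^sup>2 / (2 * \<sigma>\<^sup>2))"
proof -
  let ?v = "2 * pi * \<sigma>\<^sup>2"
  have v: "?v > 0" using assms by simp
  have "1 / sqrt ?v = ?v powr (- (1 / 2))"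
    unfolding powr_minus_divide powr_half_sqrt[OF less_imp_le[OF v]] ..
  moreover have "(?v powr (- (1 / 2))) ^ DIM('a) = ?v powr (- (1 / 2) * real DIM('a))"
    using v powr_realpow[of "?v powr (- (1 / 2))" "DIM('a)"]
    unfolding powr_powr by (metis powr_gt_zero less_irrefl)
  ultimately have c: "(\<Prod>b\<in>(Basis::'a set). 1 / sqrt ?v) = ?v powr (- (real DIM('a) / 2))"
    by simp
  have "(norm (x - m))\<^sup>2 = (\<Sum>b\<in>Basis. (x \<bullet> b - m \<bullet> b)\<^sup>2)"
    unfolding power2_norm_eq_inner by (subst euclidean_inner) (simp add: inner_diff_left power2_eq_square)
  then have "(\<Prod>b\<in>(Basis::'a set). exp (- (x \<bullet> b - m \<bullet> b)\<^sup>2 / (2 * \<sigma>\<^sup>2)))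
      = exp (- (norm (x - m))\<^sup>2 / (2 * \<sigma>\<^sup>2))"
    by (simp add: exp_sum[symmetric] sum_negf sum_divide_distrib)
  with c show ?thesis
    unfolding normal_density_def prod.distrib by simp
qed

lemma nn_integral_normal_density:
  assumes "\<sigma> > 0"
  shows "(\<integral>\<^sup>+x. ennreal (normal_density \<mu> \<sigma> x) \<partial>lborel) = 1"
  using assms by (subst nn_integral_eq_integral) auto

text \<open>Parametrised by the variance \<open>v\<close>, since completing the square produces a
  variance rather than a standard deviation.\<close>

lemma nn_integral_gaussian:
  fixes m :: "'a::euclidean_space"
  assumes "v > 0"
  shows "(\<integral>\<^sup>+x. ennreal ((2 * pi * v) powr (- (real DIM('a) / 2)) * exp (- (norm (x - m))\<^sup>2 / (2 * v))) \<partial>lborel) = 1"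
proof -
  define \<sigma> where "\<sigma> = sqrt v"
  have \<sigma>: "\<sigma> > 0" "v = \<sigma>\<^sup>2" using assms by (auto simp: \<sigma>_def)
  have "(\<integral>\<^sup>+x. (\<Prod>b\<in>Basis. ennreal (normal_density (m \<bullet> b) \<sigma> (x \<bullet> b))) \<partial>lborel) = 1"
    using \<sigma> by (subst nn_integral_lborel_prod) (simp_all add: nn_integral_normal_density)
  then show ?thesis
    using \<sigma> by (simp add: prod_ennreal prod_normal_density)
qed

section \<open>The standard normal distribution and Gaussian integrals against it\<close>

lemma sets_std_normal_vec[measurable_cong, simp]: "sets std_normal_vec = sets borel"
  by (simp add: std_normal_vec_def)

lemma space_std_normal_vec[simp]: "space std_normal_vec = UNIV"
  by (simp add: std_normal_vec_def)

lemma prob_space_std_normal_vec: "prob_space (std_normal_vec :: (real ^ 'd) measure)"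
proof
  show "emeasure std_normal_vec (space (std_normal_vec :: (real ^ 'd) measure)) = 1"
    using nn_integral_gaussian[of 1 "0 :: real ^ 'd"]
    by (simp add: std_normal_vec_def emeasure_density)
qed

text \<open>As a quadratic in \<open>x\<close>, the left side has precision
  \<open>1 + 1 / s\<close>, hence variance \<open>s / (1 + s)\<close> and mean
  \<open>y / (1 + s)\<close>. What remains is the exponent of a centred Gaussian in \<open>y\<close>
  with variance \<open>1 + s\<close>.\<close>

lemma complete_square_two_gaussians:
  fixes x y :: "'a::real_inner"
  assumes "s > 0"
  shows "- (norm x)\<^sup>2 / 2 - (norm (x - y))\<^sup>2 / (2 * s)
    = - (norm y)\<^sup>2 / (2 * (1 + s)) - (norm (x - (1 / (1 + s)) *\<^sub>R y))\<^sup>2 / (2 * (s / (1 + s)))"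
proof -
  \<comment> \<open>Scalar form, with \<open>a\<close>, \<open>b\<close>, \<open>c\<close> standing
    for \<open>x \<bullet> x\<close>, \<open>x \<bullet> y\<close>, \<open>y \<bullet> y\<close>.
    Denominators are cleared with \<open>t\<close> opaque; only then is \<open>t = 1 + s\<close>
    used to cancel a factor \<open>t\<close>.\<close>
  have id: "- a / 2 - (a - 2 * b + c) / (2 * s)
      = - c / (2 * t) - (a - 2 * (b / t) + c / t\<^sup>2) / (2 * (s / t))" if "t = 1 + s" for a b c t
  proof -
    have "t > 0" using that assms by simp
    then have "- c / (2 * t) - (a - 2 * (b / t) + c / t\<^sup>2) / (2 * (s / t))
        = (- c * s - a * t\<^sup>2 + 2 * b * t - c) / (2 * s * t)"
      using assms by (simp add: divide_simps power2_eq_square) (simp add: algebra_simps)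
    also have "- c * s - a * t\<^sup>2 + 2 * b * t - c = t * (- a * t + 2 * b - c)"
      by (simp add: that algebra_simps power2_eq_square)
    also have "\<dots> / (2 * s * t) = (- a * t + 2 * b - c) / (2 * s)"
      using \<open>t > 0\<close> by simp
    also have "\<dots> = - a / 2 - (a - 2 * b + c) / (2 * s)"
      using assms by (simp add: that field_simps)
    finally show ?thesis by simp
  qed
  have "(norm (x - y))\<^sup>2 = x \<bullet> x - 2 * (x \<bullet> y) + y \<bullet> y"
    by (simp add: power2_norm_eq_inner inner_diff inner_commute)
  moreover have "(norm (x - (1 / (1 + s)) *\<^sub>R y))\<^sup>2
      = x \<bullet> x - 2 * ((x \<bullet> y) / (1 + s)) + (y \<bullet> y) / (1 + s)\<^sup>2"
    unfolding power2_norm_eq_inner by (simp add: inner_diff inner_commute power2_eq_square)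
  ultimately show ?thesis
    using id[of "1 + s" "x \<bullet> x" "x \<bullet> y" "y \<bullet> y"] by (simp add: power2_norm_eq_inner)
qed

text \<open>Completing the square turns the integrand into the constant \<open>?A\<close> times a
  normal density \<open>?g\<close> of total mass 1. Computing with the nonnegative integral avoids a
  separate integrability proof. Every Gaussian integral of the final formula comes from instances of
  this one.\<close>

lemma integral_std_normal_vec_gaussian:
  fixes y :: "real ^ 'd"
  assumes s: "s > 0"
  shows "(\<integral>x. exp (- (norm (x - y))\<^sup>2 / (2 * s)) \<partial>std_normal_vec)
    = (s / (1 + s)) powr (real CARD('d) / 2) * exp (- (norm y)\<^sup>2 / (2 * (1 + s)))"
proof -
  define v where "v = s / (1 + s)"
  let ?d = "real CARD('d) / 2"
  let ?A = "v powr ?d * exp (- (norm y)\<^sup>2 / (2 * (1 + s)))"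
  let ?g = "\<lambda>x. (2 * pi * v) powr (- ?d) * exp (- (norm (x - (1 / (1 + s)) *\<^sub>R y))\<^sup>2 / (2 * v))"
  have v: "v > 0" using s by (simp add: v_def)
  have eq: "(2 * pi) powr (- ?d) * exp (- (norm x)\<^sup>2 / 2) * exp (- (norm (x - y))\<^sup>2 / (2 * s)) = ?A * ?g x" for x
  proof -
    have expo: "exp (- (norm x)\<^sup>2 / 2) * exp (- (norm (x - y))\<^sup>2 / (2 * s))
        = exp (- (norm y)\<^sup>2 / (2 * (1 + s))) * exp (- (norm (x - (1 / (1 + s)) *\<^sub>R y))\<^sup>2 / (2 * v))"
      using complete_square_two_gaussians[OF s, of x y] by (simp add: exp_add[symmetric] v_def)
    have const: "v powr ?d * (2 * pi * v) powr (- ?d) = (2 * pi) powr (- ?d)"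
      using v by (simp add: powr_mult powr_minus)
    have "(2 * pi) powr (- ?d) * exp (- (norm x)\<^sup>2 / 2) * exp (- (norm (x - y))\<^sup>2 / (2 * s))
        = (v powr ?d * (2 * pi * v) powr (- ?d)) * (exp (- (norm x)\<^sup>2 / 2) * exp (- (norm (x - y))\<^sup>2 / (2 * s)))"
      unfolding const by (simp only: mult.assoc)
    then show ?thesis
      unfolding expo by (simp only: mult_ac)
  qed
  have "(\<integral>\<^sup>+x. ennreal (exp (- (norm (x - y))\<^sup>2 / (2 * s))) \<partial>std_normal_vec)
      = (\<integral>\<^sup>+x. ennreal (?A * ?g x) \<partial>lborel)"
    unfolding eq[symmetric] std_normal_vec_def by (subst nn_integral_density) (auto simp: ennreal_mult')
  also have "\<dots> = ennreal ?A * (\<integral>\<^sup>+x. ennreal (?g x) \<partial>lborel)"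
    by (subst nn_integral_cmult[symmetric]) (auto simp: ennreal_mult'[symmetric])
  also have "\<dots> = ennreal ?A"
    using nn_integral_gaussian[OF v, of "(1 / (1 + s)) *\<^sub>R y"] by simp
  finally show ?thesis
    by (subst integral_eq_nn_integral) (auto simp: v_def)
qed

section \<open>Variance of U-statistics with a bounded symmetric kernel\<close>

text \<open>Boundedness on a probability space makes all the integrands below integrable. The locale
  is instantiated both with the original kernel and with its centred version.\<close>

locale bounded_symmetric_kernel = prob_space P for P :: "'a measure" +
  fixes k :: "'a \<Rightarrow> 'a \<Rightarrow> real" and C :: real
  assumes measurable_kernel: "case_prod k \<in> borel_measurable (P \<Otimes>\<^sub>M P)"
    and kernel_sym: "k x y = k y x"
    and kernel_bound: "\<bar>k x y\<bar> \<le> C"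
begin

sublocale pair: pair_prob_space P P ..

lemma measurable_kernel'[measurable (raw)]:
  assumes "f \<in> measurable N P" "g \<in> measurable N P"
  shows "(\<lambda>x. k (f x) (g x)) \<in> borel_measurable N"
  using measurable_compose[OF measurable_Pair[OF assms] measurable_kernel] by simp

lemma bound_nonneg: "C \<ge> 0"
  using kernel_bound[of undefined undefined] by linarith

lemma integrable_bounded_pair:
  fixes f :: "'a \<Rightarrow> 'a \<Rightarrow> real"
  assumes "case_prod f \<in> borel_measurable (P \<Otimes>\<^sub>M P)" "\<And>x y. \<bar>f x y\<bar> \<le> B"
  shows "integrable (P \<Otimes>\<^sub>M P) (case_prod f)"
  using assms by (intro pair.integrable_const_bound[where B = B]) auto

lemma integrable_kernel_left: "y \<in> space P \<Longrightarrow> integrable P (\<lambda>x. k x y)"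
  by (rule integrable_const_bound[where B = C]) (auto simp: kernel_bound)

section \<open>Mean embedding and centring of a kernel\<close>

text \<open>\<open>embed\<close>, \<open>total\<close> and \<open>centered\<close> are \<open>mu\<close>, \<open>c\<close> and \<open>h\<close> of the introductory remark.\<close>

definition embed :: "'a \<Rightarrow> real" where "embed y = (\<integral>x. k x y \<partial>P)"

definition total :: real where "total = (\<integral>(x, y). k x y \<partial>(P \<Otimes>\<^sub>M P))"

definition centered :: "'a \<Rightarrow> 'a \<Rightarrow> real" where
  "centered x y = k x y - embed x - embed y + total"

lemma measurable_embed[measurable]: "embed \<in> borel_measurable P"
  unfolding embed_def by measurable

lemma embed_bound: "\<bar>embed y\<bar> \<le> C"
proof (cases "integrable P (\<lambda>x. k x y)")
  case True
  have "\<bar>\<integral>x. k x y \<partial>P\<bar> \<le> (\<integral>x. \<bar>k x y\<bar> \<partial>P)" by (rule integral_abs_bound)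
  also have "\<dots> \<le> C"
    using True by (intro integral_le_const) (auto simp: kernel_bound)
  finally show ?thesis by (simp add: embed_def)
next
  \<comment> \<open>A non-integrable section has Bochner integral 0 by convention, so the bound
    reduces to \<open>0 \<le> C\<close>. This makes the bound available at every point of the type,
    as the locale demands of \<open>centered\<close>.\<close>
  case False
  then show ?thesis by (simp add: embed_def not_integrable_integral_eq bound_nonneg)
qed

lemma integrable_embed: "integrable P embed"
  by (rule integrable_const_bound[where B = C]) (auto simp: embed_bound)

lemma integral_kernel_eq_embed: "(\<integral>y. k x y \<partial>P) = embed x"
  by (simp add: embed_def kernel_sym[of x])

lemma integrable_kernel: "integrable (P \<Otimes>\<^sub>M P) (\<lambda>(x, y). k x y)"
  by (rule integrable_bounded_pair[OF measurable_kernel kernel_bound])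

lemma kernel_square_bound: "(k x y)\<^sup>2 \<le> C\<^sup>2"
  using kernel_bound[of x y] bound_nonneg by (simp add: abs_le_square_iff[symmetric])

lemma integrable_kernel_square: "integrable (P \<Otimes>\<^sub>M P) (\<lambda>(x, y). (k x y)\<^sup>2)"
  by (rule integrable_bounded_pair[where B = "C\<^sup>2"]) (measurable, auto simp: kernel_square_bound)

lemma total_eq: "total = (\<integral>x. embed x \<partial>P)"
  unfolding total_def using pair.integral_snd[OF integrable_kernel] by (simp add: embed_def)

lemma total_bound: "\<bar>total\<bar> \<le> C"
proof -
  have "\<bar>\<integral>x. embed x \<partial>P\<bar> \<le> (\<integral>x. \<bar>embed x\<bar> \<partial>P)" by (rule integral_abs_bound)
  also have "\<dots> \<le> C"
    using integrable_embed by (intro integral_le_const) (auto simp: embed_bound)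
  finally show ?thesis by (simp add: total_eq)
qed

text \<open>Makes the results of the locale applicable to \<open>centered\<close> itself; the factor
  4 counts its four terms, each bounded by \<open>C\<close>.\<close>

lemma bounded_symmetric_kernel_centered: "bounded_symmetric_kernel P centered (4 * C)"
proof
  show "case_prod centered \<in> borel_measurable (P \<Otimes>\<^sub>M P)"
    unfolding centered_def by measurable
  show "centered x y = centered y x" for x y
    by (simp add: centered_def kernel_sym)
  show "\<bar>centered x y\<bar> \<le> 4 * C" for x y
    using kernel_bound[of x y] embed_bound[of x] embed_bound[of y] total_bound
    unfolding centered_def by linarith
qed

text \<open>Degeneracy: integrating the four terms over \<open>x\<close> gives
  \<open>embed y - total - embed y + total\<close>.\<close>

lemma integral_centered:
  assumes "y \<in> space P"
  shows "(\<integral>x. centered x y \<partial>P) = 0"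
  unfolding centered_def using integrable_kernel_left[OF assms] integrable_embed
  by (simp add: total_eq embed_def[symmetric] prob_space)

lemma integral_centered': "x \<in> space P \<Longrightarrow> (\<integral>y. centered x y \<partial>P) = 0"
  using integral_centered[of x]
  by (simp add: bounded_symmetric_kernel.kernel_sym[OF bounded_symmetric_kernel_centered, of x])

text \<open>By degeneracy \<open>centered\<close> is orthogonal to every bounded function of one
  variable, so one of its two factors may be replaced by \<open>k\<close> before the other is
  expanded.\<close>

lemma integral_centered_square:
  "(\<integral>(x, y). (centered x y)\<^sup>2 \<partial>(P \<Otimes>\<^sub>M P))
    = (\<integral>(x, y). (k x y)\<^sup>2 \<partial>(P \<Otimes>\<^sub>M P)) - 2 * (\<integral>x. (embed x)\<^sup>2 \<partial>P) + total\<^sup>2"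
proof -
  interpret c: bounded_symmetric_kernel P centered "4 * C"
    by (rule bounded_symmetric_kernel_centered)
  let ?PP = "P \<Otimes>\<^sub>M P"
  note bounds = kernel_bound embed_bound c.kernel_bound c.bound_nonneg bound_nonneg
  have bnd: "\<bar>u * v\<bar> \<le> B * C" if "\<bar>u\<bar> \<le> B" "\<bar>v\<bar> \<le> C" "0 \<le> B" for u v B
    using that bound_nonneg by (simp add: abs_mult mult_mono)
  have i1: "integrable ?PP (\<lambda>(x, y). centered x y * k x y)"
    by (rule integrable_bounded_pair[where B = "4 * C * C"]) (measurable, auto intro!: bnd bounds)
  have i2: "integrable ?PP (\<lambda>(x, y). centered x y * embed y)"
    by (rule integrable_bounded_pair[where B = "4 * C * C"]) (measurable, auto intro!: bnd bounds)
  have i3: "integrable ?PP (\<lambda>(x, y). centered x y * embed x)"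
    by (rule integrable_bounded_pair[where B = "4 * C * C"]) (measurable, auto intro!: bnd bounds)
  have j2: "integrable ?PP (\<lambda>(x, y). k x y * embed y)"
    by (rule integrable_bounded_pair[where B = "C * C"]) (measurable, auto intro!: bnd bounds)
  have j3: "integrable ?PP (\<lambda>(x, y). k x y * embed x)"
    by (rule integrable_bounded_pair[where B = "C * C"]) (measurable, auto intro!: bnd bounds)
  have z2: "(\<integral>(x, y). centered x y * embed y \<partial>?PP) = 0"
    unfolding pair.integral_snd[OF i2, symmetric]
    by (simp add: integral_centered cong: Bochner_Integration.integral_cong)
  have z3: "(\<integral>(x, y). centered x y * embed x \<partial>?PP) = 0"
    unfolding pair.integral_fst[OF i3, symmetric]
    by (simp add: integral_centered' cong: Bochner_Integration.integral_cong)
  have k2: "(\<integral>(x, y). k x y * embed y \<partial>?PP) = (\<integral>x. (embed x)\<^sup>2 \<partial>P)"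
    unfolding pair.integral_snd[OF j2, symmetric]
    by (simp add: embed_def[symmetric] power2_eq_square)
  have k3: "(\<integral>(x, y). k x y * embed x \<partial>?PP) = (\<integral>x. (embed x)\<^sup>2 \<partial>P)"
    unfolding pair.integral_fst[OF j3, symmetric]
    by (simp add: integral_kernel_eq_embed power2_eq_square)
  \<comment> \<open>Only one factor is expanded here; of the four products, just
    \<open>centered x y * k x y\<close> has a nonzero contribution.\<close>
  have "(\<integral>(x, y). (centered x y)\<^sup>2 \<partial>?PP)
      = (\<integral>p. (case p of (x, y) \<Rightarrow> centered x y * k x y) - (case p of (x, y) \<Rightarrow> centered x y * embed x)
          - (case p of (x, y) \<Rightarrow> centered x y * embed y) + total * (case p of (x, y) \<Rightarrow> centered x y) \<partial>?PP)"
    by (rule Bochner_Integration.integral_cong)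
       (auto simp: centered_def power2_eq_square algebra_simps)
  also have "\<dots> = (\<integral>(x, y). centered x y * k x y \<partial>?PP) + total * (\<integral>(x, y). centered x y \<partial>?PP)"
    using i1 i2 i3 z2 z3 c.integrable_kernel by (simp add: split_beta')
  also have "(\<integral>(x, y). centered x y \<partial>?PP) = 0"
    unfolding pair.integral_snd[OF c.integrable_kernel, symmetric]
    by (simp add: integral_centered cong: Bochner_Integration.integral_cong)
  \<comment> \<open>Expansion of the remaining factor: integrating out the variable absent from
    \<open>embed\<close> turns \<open>k\<close> into \<open>embed\<close>, so both mixed terms give
    the second moment of \<open>embed\<close>.\<close>
  also have "(\<integral>(x, y). centered x y * k x y \<partial>?PP)
      = (\<integral>p. (case p of (x, y) \<Rightarrow> (k x y)\<^sup>2) - (case p of (x, y) \<Rightarrow> k x y * embed x)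
          - (case p of (x, y) \<Rightarrow> k x y * embed y) + total * (case p of (x, y) \<Rightarrow> k x y) \<partial>?PP)"
    by (rule Bochner_Integration.integral_cong)
       (auto simp: centered_def power2_eq_square algebra_simps)
  also have "\<dots> = (\<integral>(x, y). (k x y)\<^sup>2 \<partial>?PP) - 2 * (\<integral>x. (embed x)\<^sup>2 \<partial>P) + total\<^sup>2"
    using integrable_kernel_square j2 j3 k2 k3 integrable_kernel
    by (simp add: total_def split_beta' power2_eq_square)
  finally show ?thesis by simp
qed

section \<open>Moments of degenerate U-statistics\<close>

text \<open>Coordinate \<open>i\<close> is integrated out first: \<open>x j\<close> and
  \<open>g x\<close> do not depend on it, so the inner integral vanishes by degeneracy. In use,
  \<open>g\<close> is the other kernel of a covariance, or the constant 1 for the mean.\<close>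

lemma integral_PiM_degenerate:
  fixes g :: "('i \<Rightarrow> 'a) \<Rightarrow> real"
  assumes degenerate: "\<And>y. y \<in> space P \<Longrightarrow> (\<integral>x. k x y \<partial>P) = 0"
    and I: "finite I" "i \<in> I" "j \<in> I" "i \<noteq> j"
    and g: "g \<in> borel_measurable (\<Pi>\<^sub>M i\<in>I. P)" "\<And>x. \<bar>g x\<bar> \<le> B" "\<And>x y. g (x(i := y)) = g x"
  shows "(\<integral>x. k (x i) (x j) * g x \<partial>(\<Pi>\<^sub>M i\<in>I. P)) = 0"
proof -
  interpret product_sigma_finite "\<lambda>_::'i. P" ..
  interpret PI: prob_space "\<Pi>\<^sub>M i\<in>I. P" by (intro prob_space_PiM prob_space_axioms)
  let ?J = "I - {i}"
  have "0 \<le> B" using g(2)[of undefined] by linarith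
  then have int: "integrable (\<Pi>\<^sub>M i\<in>I. P) (\<lambda>x. k (x i) (x j) * g x)"
    using I g
    by (intro PI.integrable_const_bound[where B = "C * B"])
       (auto simp: abs_mult intro!: mult_mono kernel_bound bound_nonneg)
  have "(\<integral>x. k (x i) (x j) * g x \<partial>(\<Pi>\<^sub>M i\<in>I. P))
      = (\<integral>x. (\<integral>y. k y (x j) * g x \<partial>P) \<partial>(\<Pi>\<^sub>M i\<in>?J. P))"
    using product_integral_insert[of ?J i "\<lambda>x. k (x i) (x j) * g x"] I int
    by (simp add: insert_absorb g(3))
  also have "\<dots> = (\<integral>x. 0 \<partial>(\<Pi>\<^sub>M i\<in>?J. P))"
    using I by (intro Bochner_Integration.integral_cong) (auto simp: degenerate space_PiM PiE_def Pi_def)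
  finally show ?thesis by simp
qed

text \<open>After integrating out coordinate \<open>i\<close>, the integrand depends on coordinate
  \<open>j\<close> alone, whose marginal is \<open>P\<close>; Fubini then gives the double
  integral.\<close>

lemma integral_PiM_pair:
  assumes I: "finite I" "i \<in> I" "j \<in> I" "i \<noteq> j"
  shows "(\<integral>x. (k (x i) (x j))\<^sup>2 \<partial>(\<Pi>\<^sub>M i\<in>I. P)) = (\<integral>(x, y). (k x y)\<^sup>2 \<partial>(P \<Otimes>\<^sub>M P))"
proof -
  interpret product_sigma_finite "\<lambda>_::'b. P" ..
  interpret PI: prob_space "\<Pi>\<^sub>M i\<in>I. P" by (intro prob_space_PiM prob_space_axioms)
  let ?J = "I - {i}"
  have int: "integrable (\<Pi>\<^sub>M i\<in>I. P) (\<lambda>x. (k (x i) (x j))\<^sup>2)"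
    using I by (intro PI.integrable_const_bound[where B = "C\<^sup>2"]) (auto simp: kernel_square_bound)
  have "(\<integral>x. (k (x i) (x j))\<^sup>2 \<partial>(\<Pi>\<^sub>M i\<in>I. P))
      = (\<integral>x. (\<integral>y. (k y (x j))\<^sup>2 \<partial>P) \<partial>(\<Pi>\<^sub>M i\<in>?J. P))"
    using product_integral_insert[of ?J i "\<lambda>x. (k (x i) (x j))\<^sup>2"] I int by (simp add: insert_absorb)
  also have "\<dots> = (\<integral>z. (\<integral>y. (k y z)\<^sup>2 \<partial>P) \<partial>distr (\<Pi>\<^sub>M i\<in>?J. P) P (\<lambda>x. x j))"
    using I by (subst integral_distr) auto
  also have "distr (\<Pi>\<^sub>M i\<in>?J. P) P (\<lambda>x. x j) = P"
    using I by (intro distr_PiM_component) (auto intro: prob_space_axioms)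
  also have "(\<integral>z. (\<integral>y. (k y z)\<^sup>2 \<partial>P) \<partial>P) = (\<integral>(x, y). (k x y)\<^sup>2 \<partial>(P \<Otimes>\<^sub>M P))"
    by (rule pair.integral_snd[OF integrable_kernel_square])
  finally show ?thesis .
qed


text \<open>The square expands over two ordered index pairs. A pair \<open>p\<close> correlates only
  with itself and its swap, and each contributes \<open>B\<close>, whence the factor 2 per
  pair.\<close>

lemma second_moment_degenerate_U_statistic:
  assumes degenerate: "\<And>y. y \<in> space P \<Longrightarrow> (\<integral>x. k x y \<partial>P) = 0"
    and I: "finite I"
  shows "(\<integral>x. (\<Sum>i\<in>I. \<Sum>j\<in>I - {i}. k (x i) (x j))\<^sup>2 \<partial>(\<Pi>\<^sub>M i\<in>I. P))
    = 2 * real (card I * (card I - 1)) * (\<integral>(x, y). (k x y)\<^sup>2 \<partial>(P \<Otimes>\<^sub>M P))"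
proof -
  interpret PI: prob_space "\<Pi>\<^sub>M i\<in>I. P" by (intro prob_space_PiM prob_space_axioms)
  define D where "D = Sigma I (\<lambda>i. I - {i})"
  define K where "K p x = k (x (fst p)) (x (snd p))" for p and x :: "'b \<Rightarrow> 'a"
  define B where "B = (\<integral>(x, y). (k x y)\<^sup>2 \<partial>(P \<Otimes>\<^sub>M P))"
  have [simp]: "finite D" using I by (simp add: D_def)
  have K_meas[measurable]: "K p \<in> borel_measurable (\<Pi>\<^sub>M i\<in>I. P)" if "p \<in> D" for p
  proof -
    have [measurable]: "fst p \<in> I" "snd p \<in> I" using that by (auto simp: D_def)
    show ?thesis unfolding K_def by measurable
  qed
  have K_bound: "\<bar>K p x\<bar> \<le> C" for p x
    by (simp add: K_def kernel_bound)
  have K_int: "integrable (\<Pi>\<^sub>M i\<in>I. P) (\<lambda>x. K p x * K q x)" if "p \<in> D" "q \<in> D" for p q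
  proof (rule PI.integrable_const_bound)
    show "AE x in \<Pi>\<^sub>M i\<in>I. P. norm (K p x * K q x) \<le> C * C"
      by (simp add: abs_mult mult_mono K_bound bound_nonneg)
  qed (use that in measurable)
  have swap_D: "prod.swap p \<in> D" "prod.swap p \<noteq> p" if "p \<in> D" for p
    using that by (auto simp: D_def)
  have K_swap: "K (prod.swap p) = K p" for p
    by (auto simp: K_def kernel_sym)
  have diag: "(\<integral>x. K p x * K p x \<partial>(\<Pi>\<^sub>M i\<in>I. P)) = B" if "p \<in> D" for p
    using integral_PiM_pair[OF I, of "fst p" "snd p"] that
    by (cases p) (fastforce simp add: K_def B_def D_def power2_eq_square)
  \<comment> \<open>The first index of \<open>p\<close> does not occur in \<open>q\<close>, so
    \<open>K q\<close> is constant in that coordinate and serves as \<open>g\<close>.\<close>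
  have off: "(\<integral>x. K p x * K q x \<partial>(\<Pi>\<^sub>M i\<in>I. P)) = 0"
    if "p \<in> D" "q \<in> D" "fst p \<notin> {fst q, snd q}" for p q
    unfolding K_def[of p] using that I
    by (intro integral_PiM_degenerate[OF degenerate, where B = C])
       (auto simp: D_def K_bound K_def[of q] intro: kernel_bound K_meas[unfolded K_def])
  have cov: "(\<integral>x. K p x * K q x \<partial>(\<Pi>\<^sub>M i\<in>I. P)) = 0"
    if "p \<in> D" "q \<in> D - {p, prod.swap p}" for p q
  proof (cases "fst p \<in> {fst q, snd q}")
    case True
    \<comment> \<open>If both indices of \<open>p\<close> occurred in \<open>q\<close>, then
      \<open>q\<close> would be \<open>p\<close> or its swap. So the other index of \<open>p\<close>
      is free, and symmetry of the kernel lets \<open>off\<close> be applied to the swapped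
      pair.\<close>
    with that have "fst (prod.swap p) \<notin> {fst q, snd q}"
      by (cases p; cases q) (auto simp: D_def)
    with off[of "prod.swap p" q] that swap_D[of p] show ?thesis
      by (simp add: K_swap)
  qed (use off that in auto)
  have row: "(\<Sum>q\<in>D. \<integral>x. K p x * K q x \<partial>(\<Pi>\<^sub>M i\<in>I. P)) = 2 * B" if "p \<in> D" for p
  proof -
    have "(\<Sum>q\<in>D. \<integral>x. K p x * K q x \<partial>(\<Pi>\<^sub>M i\<in>I. P))
        = (\<Sum>q\<in>{p, prod.swap p}. \<integral>x. K p x * K q x \<partial>(\<Pi>\<^sub>M i\<in>I. P))"
      using that swap_D[of p] cov[of p] by (intro sum.mono_neutral_right) auto
    then show ?thesis
      \<comment> \<open>The two surviving terms are distinct because the indices in a pair of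
        \<open>D\<close> differ.\<close>
      using that swap_D[of p] by (simp add: K_swap diag)
  qed
  have "(\<Sum>i\<in>I. \<Sum>j\<in>I - {i}. k (x i) (x j))\<^sup>2 = (\<Sum>p\<in>D. \<Sum>q\<in>D. K p x * K q x)" for x
    unfolding D_def K_def using I
    by (simp add: sum.Sigma power2_eq_square sum_product split_beta)
  then have "(\<integral>x. (\<Sum>i\<in>I. \<Sum>j\<in>I - {i}. k (x i) (x j))\<^sup>2 \<partial>(\<Pi>\<^sub>M i\<in>I. P))
      = (\<Sum>p\<in>D. \<Sum>q\<in>D. \<integral>x. K p x * K q x \<partial>(\<Pi>\<^sub>M i\<in>I. P))"
    by (simp add: K_int)
  also have "\<dots> = real (card D) * (2 * B)"
    by (simp add: row)
  also have "card D = card I * (card I - 1)"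
    using I by (simp add: D_def card_SigmaI)
  finally show ?thesis by (simp add: B_def)
qed

lemma mean_degenerate_U_statistic:
  assumes degenerate: "\<And>y. y \<in> space P \<Longrightarrow> (\<integral>x. k x y \<partial>P) = 0"
    and I: "finite I"
  shows "(\<integral>x. (\<Sum>i\<in>I. \<Sum>j\<in>I - {i}. k (x i) (x j)) \<partial>(\<Pi>\<^sub>M i\<in>I. P)) = 0"
proof -
  interpret PI: prob_space "\<Pi>\<^sub>M i\<in>I. P" by (intro prob_space_PiM prob_space_axioms)
  have int: "integrable (\<Pi>\<^sub>M i\<in>I. P) (\<lambda>x. k (x i) (x j))" if "i \<in> I" "j \<in> I" for i j
    using that by (intro PI.integrable_const_bound[where B = C]) (auto simp: kernel_bound)
  have zero: "(\<integral>x. k (x i) (x j) \<partial>(\<Pi>\<^sub>M i\<in>I. P)) = 0" if "i \<in> I" "j \<in> I - {i}" for i j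
    using integral_PiM_degenerate[OF degenerate I, of i j "\<lambda>_. 1" 1] that by auto
  have "(\<integral>x. (\<Sum>i\<in>I. \<Sum>j\<in>I - {i}. k (x i) (x j)) \<partial>(\<Pi>\<^sub>M i\<in>I. P))
      = (\<Sum>i\<in>I. \<integral>x. (\<Sum>j\<in>I - {i}. k (x i) (x j)) \<partial>(\<Pi>\<^sub>M i\<in>I. P))"
    by (intro Bochner_Integration.integral_sum Bochner_Integration.integrable_sum int) auto
  also have "\<dots> = (\<Sum>i\<in>I. \<Sum>j\<in>I - {i}. \<integral>x. k (x i) (x j) \<partial>(\<Pi>\<^sub>M i\<in>I. P))"
    by (intro sum.cong refl Bochner_Integration.integral_sum int) auto
  finally show ?thesis by (simp add: zero)
qed

text \<open>Transports the moments from the product measure to an arbitrary i.i.d. sample: the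
  statistic depends on the sample only through its joint law.\<close>

lemma variance_degenerate_U_statistic:
  fixes Z :: "'i \<Rightarrow> 'w \<Rightarrow> 'a"
  assumes degenerate: "\<And>y. y \<in> space P \<Longrightarrow> (\<integral>x. k x y \<partial>P) = 0"
    and I: "finite I" "I \<noteq> {}"
    and M: "prob_space M" and indep: "prob_space.indep_vars M (\<lambda>_. N) Z I"
    and dist: "\<And>i. i \<in> I \<Longrightarrow> distr M N (Z i) = P"
  shows "prob_space.variance M (\<lambda>\<omega>. \<Sum>i\<in>I. \<Sum>j\<in>I - {i}. k (Z i \<omega>) (Z j \<omega>))
    = 2 * real (card I * (card I - 1)) * (\<integral>(x, y). (k x y)\<^sup>2 \<partial>(P \<Otimes>\<^sub>M P))"
proof -
  interpret M: prob_space M by (rule M)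
  let ?U = "\<lambda>x. \<Sum>i\<in>I. \<Sum>j\<in>I - {i}. k (x i) (x j)"
  have Z[measurable]: "Z i \<in> measurable M N" if "i \<in> I" for i
    using indep that by (auto simp: M.indep_vars_def)
  \<comment> \<open>Some index exists because \<open>I\<close> is nonempty, and the law of that
    variable carries the sets of \<open>N\<close>.\<close>
  have PN[measurable_cong]: "sets P = sets N"
    using dist I by fastforce
  have joint: "distr M (\<Pi>\<^sub>M i\<in>I. N) (\<lambda>\<omega>. \<lambda>i\<in>I. Z i \<omega>) = (\<Pi>\<^sub>M i\<in>I. P)"
    using M.indep_vars_iff_distr_eq_PiM'[where I = I and M' = "\<lambda>_. N" and X = Z] I Z indep
    by (simp add: dist cong: PiM_cong)
  \<comment> \<open>Applied below to the identity and to the square; as the mean is 0, the variance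
    is the second moment.\<close>
  have transfer: "(\<integral>\<omega>. f (?U (\<lambda>i. Z i \<omega>)) \<partial>M) = (\<integral>x. f (?U x) \<partial>(\<Pi>\<^sub>M i\<in>I. P))"
    if [measurable]: "f \<in> borel_measurable borel" for f :: "real \<Rightarrow> real"
  proof -
    have "(\<integral>x. f (?U x) \<partial>distr M (\<Pi>\<^sub>M i\<in>I. N) (\<lambda>\<omega>. \<lambda>i\<in>I. Z i \<omega>))
        = (\<integral>\<omega>. f (?U (\<lambda>i\<in>I. Z i \<omega>)) \<partial>M)"
      by (rule integral_distr) measurable
    also have "\<dots> = (\<integral>\<omega>. f (?U (\<lambda>i. Z i \<omega>)) \<partial>M)"
      by simp
    finally show ?thesis by (simp add: joint)
  qed
  have "M.expectation (\<lambda>\<omega>. ?U (\<lambda>i. Z i \<omega>)) = 0"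
    using transfer[of "\<lambda>u. u"] mean_degenerate_U_statistic[OF degenerate I(1)] by simp
  then show ?thesis
    using transfer[of "\<lambda>u. u\<^sup>2"] second_moment_degenerate_U_statistic[OF degenerate I(1)] by simp
qed

text \<open>A pointwise identity: each \<open>embed (z i)\<close> occurs \<open>n - 1\<close> times
  in either slot of the double sum, so dividing by \<open>n * (n - 1)\<close> leaves the coefficient
  \<open>2 / n\<close>.\<close>

lemma U_statistic_centered:
  assumes I: "finite I" "card I \<ge> 2" and n: "n = real (card I)"
  shows "total - 2 / n * (\<Sum>i\<in>I. embed (z i)) + 1 / (n * (n - 1)) * (\<Sum>i\<in>I. \<Sum>j\<in>I - {i}. k (z i) (z j))
    = 1 / (n * (n - 1)) * (\<Sum>i\<in>I. \<Sum>j\<in>I - {i}. centered (z i) (z j))"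
proof -
  define S where "S = (\<Sum>i\<in>I. embed (z i))"
  have n2: "n \<ge> 2" using I n by simp
  \<comment> \<open>The coefficient \<open>n - 2\<close> combines the \<open>n - 1\<close> copies of
    \<open>embed (z i)\<close> from the first slot with the one copy by which the second-slot sum
    falls short of \<open>S\<close>.\<close>
  have row: "(\<Sum>j\<in>I - {i}. centered (z i) (z j))
      = (\<Sum>j\<in>I - {i}. k (z i) (z j)) - (n - 2) * embed (z i) - S + (n - 1) * total" if "i \<in> I" for i
  proof -
    have others: "(\<Sum>j\<in>I - {i}. embed (z j)) = S - embed (z i)"
      using I that by (simp add: S_def sum_diff1)
    have card: "real (card (I - {i})) = n - 1"
      using I that n by (simp add: of_nat_diff)
    show ?thesis
      unfolding centered_def sum.distrib sum_subtractf sum_constant others card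
      by (simp add: algebra_simps)
  qed
  have "(\<Sum>i\<in>I. \<Sum>j\<in>I - {i}. centered (z i) (z j))
      = (\<Sum>i\<in>I. \<Sum>j\<in>I - {i}. k (z i) (z j)) - (n - 2) * S - n * S + n * (n - 1) * total"
    by (simp add: row sum.distrib sum_subtractf sum_distrib_left[symmetric] S_def[symmetric] n[symmetric])
  also have "\<dots> = n * (n - 1) * (total - 2 / n * S + 1 / (n * (n - 1)) * (\<Sum>i\<in>I. \<Sum>j\<in>I - {i}. k (z i) (z j)))"
    using n2 by (simp add: field_simps)
  finally show ?thesis
    using n2 by (simp add: S_def)
qed

end

section \<open>The Gaussian kernel under the standard normal distribution\<close>

text \<open>The one-variable integral is used twice: integrating out \<open>x\<close> leaves a
  centred Gaussian in \<open>y\<close> with \<open>1 + s\<close> in place of \<open>s\<close>, and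
  the factors \<open>1 + s\<close> cancel.\<close>

lemma integral_pair_std_normal_vec_gaussian:
  assumes s: "s > 0"
  shows "(\<integral>(x, y). exp (- (norm (x - y))\<^sup>2 / (2 * s)) \<partial>(std_normal_vec \<Otimes>\<^sub>M (std_normal_vec :: (real ^ 'd) measure)))
    = (s / (2 + s)) powr (real CARD('d) / 2)"
proof -
  let ?P = "std_normal_vec :: (real ^ 'd) measure"
  interpret prob_space ?P by (rule prob_space_std_normal_vec)
  interpret pair: pair_prob_space ?P ?P ..
  have int: "integrable (?P \<Otimes>\<^sub>M ?P) (\<lambda>(x, y). exp (- (norm (x - y))\<^sup>2 / (2 * s)))"
    using s by (intro pair.integrable_const_bound[where B = 1]) (auto, measurable)
  have "(\<integral>(x, y). exp (- (norm (x - y))\<^sup>2 / (2 * s)) \<partial>(?P \<Otimes>\<^sub>M ?P))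
      = (s / (1 + s)) powr (real CARD('d) / 2) * (\<integral>y. exp (- (norm (y - 0))\<^sup>2 / (2 * (1 + s))) \<partial>?P)"
    unfolding pair.integral_snd[OF int, symmetric] integral_std_normal_vec_gaussian[OF s] by simp
  also have "\<dots> = (s / (1 + s)) powr (real CARD('d) / 2) * ((1 + s) / (2 + s)) powr (real CARD('d) / 2)"
    using s by (subst integral_std_normal_vec_gaussian) auto
  also have "\<dots> = (s / (2 + s)) powr (real CARD('d) / 2)"
    using s by (simp add: powr_mult[symmetric])
  finally show ?thesis .
qed

lemma bounded_symmetric_kernel_rbf:
  "bounded_symmetric_kernel (std_normal_vec :: (real ^ 'd) measure) (rbf_kernel \<gamma>) 1"
proof -
  interpret prob_space "std_normal_vec :: (real ^ 'd) measure" by (rule prob_space_std_normal_vec)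
  show ?thesis
  proof
    show "case_prod (rbf_kernel \<gamma>) \<in> borel_measurable (std_normal_vec \<Otimes>\<^sub>M (std_normal_vec :: (real ^ 'd) measure))"
      unfolding rbf_kernel_def by measurable
  qed (auto simp: rbf_kernel_def norm_minus_commute)
qed

theorem mainTheorem1:
  fixes \<gamma> :: real and n :: nat
  assumes "\<gamma> > 0" and "n \<ge> 2"
  shows
    "(\<forall>z :: nat \<Rightarrow> real ^ 'd.
        mmd_u_sq \<gamma> std_normal_vec n z =
          (\<gamma>\<^sup>2 / (2 + \<gamma>\<^sup>2)) powr (real CARD('d) / 2)
          - 2 / real n * (\<gamma>\<^sup>2 / (1 + \<gamma>\<^sup>2)) powr (real CARD('d) / 2)
              * (\<Sum>i\<in>{1..n}. exp (- (norm (z i))\<^sup>2 / (2 * (1 + \<gamma>\<^sup>2))))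
          + 1 / (real n * (real n - 1))
              * (\<Sum>i\<in>{1..n}. \<Sum>j\<in>{1..n} - {i}. exp (- (norm (z i - z j))\<^sup>2 / (2 * \<gamma>\<^sup>2))))
     \<and>
     (\<forall>(M :: 'w measure) (Z :: nat \<Rightarrow> 'w \<Rightarrow> real ^ 'd).
        prob_space M \<longrightarrow>
        prob_space.indep_vars M (\<lambda>_. borel) Z {1..n} \<longrightarrow>
        (\<forall>i\<in>{1..n}. distr M borel (Z i) = std_normal_vec) \<longrightarrow>
        prob_space.variance M (\<lambda>\<omega>. mmd_u_sq \<gamma> std_normal_vec n (\<lambda>i. Z i \<omega>)) =
          2 / (real n * (real n - 1)) *
            ((\<gamma>\<^sup>2 / (2 + \<gamma>\<^sup>2)) ^ CARD('d)
             + (\<gamma>\<^sup>2 / (4 + \<gamma>\<^sup>2)) powr (real CARD('d) / 2)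
             - 2 * (\<gamma> ^ 4 / ((1 + \<gamma>\<^sup>2) * (3 + \<gamma>\<^sup>2))) powr (real CARD('d) / 2)))"
proof -
  let ?P = "std_normal_vec :: (real ^ 'd) measure"
  let ?d = "real CARD('d) / 2"
  interpret bounded_symmetric_kernel ?P "rbf_kernel \<gamma>" 1
    by (rule bounded_symmetric_kernel_rbf)
  interpret c: bounded_symmetric_kernel ?P centered "4 * 1"
    by (rule bounded_symmetric_kernel_centered)
  have \<gamma>: "\<gamma>\<^sup>2 > 0" using assms by simp
  have embed_eq: "embed y = (\<gamma>\<^sup>2 / (1 + \<gamma>\<^sup>2)) powr ?d * exp (- (norm y)\<^sup>2 / (2 * (1 + \<gamma>\<^sup>2)))" for y
    unfolding embed_def rbf_kernel_def by (rule integral_std_normal_vec_gaussian[OF \<gamma>])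
  have total_eq: "total = (\<gamma>\<^sup>2 / (2 + \<gamma>\<^sup>2)) powr ?d"
    unfolding total_def rbf_kernel_def by (rule integral_pair_std_normal_vec_gaussian[OF \<gamma>])
  \<comment> \<open>Squaring the kernel halves the squared width, so its integral is the same
    formula at \<open>\<gamma>\<^sup>2 / 2\<close>.\<close>
  have "(rbf_kernel \<gamma> x y)\<^sup>2 = exp (- (norm (x - y))\<^sup>2 / (2 * (\<gamma>\<^sup>2 / 2)))" for x y :: "real ^ 'd"
    by (simp add: rbf_kernel_def exp_double[symmetric])
  then have "(\<integral>(x, y). (rbf_kernel \<gamma> x y)\<^sup>2 \<partial>(?P \<Otimes>\<^sub>M ?P)) = (\<gamma>\<^sup>2 / 2 / (2 + \<gamma>\<^sup>2 / 2)) powr ?d"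
    using integral_pair_std_normal_vec_gaussian[of "\<gamma>\<^sup>2 / 2", where 'd = 'd] \<gamma> by simp
  also have "\<gamma>\<^sup>2 / 2 / (2 + \<gamma>\<^sup>2 / 2) = \<gamma>\<^sup>2 / (4 + \<gamma>\<^sup>2)"
    using \<gamma> by (simp add: field_simps)
  finally have k2: "(\<integral>(x, y). (rbf_kernel \<gamma> x y)\<^sup>2 \<partial>(?P \<Otimes>\<^sub>M ?P)) = (\<gamma>\<^sup>2 / (4 + \<gamma>\<^sup>2)) powr ?d" .
  \<comment> \<open>The squared embedding is again a Gaussian, now with parameter
    \<open>(1 + \<gamma>\<^sup>2) / 2\<close>; \<open>x - 0\<close> puts it in the shape of the
    integral formula with centre 0.\<close>
  have "(embed x)\<^sup>2 = ((\<gamma>\<^sup>2 / (1 + \<gamma>\<^sup>2)) powr ?d)\<^sup>2 * exp (- (norm (x - 0))\<^sup>2 / (2 * ((1 + \<gamma>\<^sup>2) / 2)))" for x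
    by (simp add: embed_eq power_mult_distrib exp_double[symmetric])
  then have "(\<integral>x. (embed x)\<^sup>2 \<partial>?P)
      = ((\<gamma>\<^sup>2 / (1 + \<gamma>\<^sup>2)) powr ?d)\<^sup>2 * ((1 + \<gamma>\<^sup>2) / 2 / (1 + (1 + \<gamma>\<^sup>2) / 2)) powr ?d"
    using integral_std_normal_vec_gaussian[of "(1 + \<gamma>\<^sup>2) / 2" "0 :: real ^ 'd"] \<gamma> by simp
  also have "\<dots> = (\<gamma>\<^sup>2 / (1 + \<gamma>\<^sup>2) * (\<gamma>\<^sup>2 / (1 + \<gamma>\<^sup>2)) * ((1 + \<gamma>\<^sup>2) / 2 / (1 + (1 + \<gamma>\<^sup>2) / 2))) powr ?d"
    unfolding power2_eq_square[of "_ powr _"] powr_mult[symmetric] ..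
  also have "\<gamma>\<^sup>2 / (1 + \<gamma>\<^sup>2) * (\<gamma>\<^sup>2 / (1 + \<gamma>\<^sup>2)) * ((1 + \<gamma>\<^sup>2) / 2 / (1 + (1 + \<gamma>\<^sup>2) / 2))
      = \<gamma> ^ 4 / ((1 + \<gamma>\<^sup>2) * (3 + \<gamma>\<^sup>2))"
  proof -
    have "\<gamma> ^ 4 = \<gamma>\<^sup>2 * \<gamma>\<^sup>2" by (simp flip: power_add)
    moreover have "a / (1 + a) * (a / (1 + a)) * ((1 + a) / 2 / (1 + (1 + a) / 2)) = a * a / ((1 + a) * (3 + a))"
      if "a > 0" for a :: real
    proof -
      have "(1 + a) / 2 / (1 + (1 + a) / 2) = (1 + a) / (3 + a)"
        using that by (simp add: field_simps)
      then show ?thesis using that by simp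
    qed
    ultimately show ?thesis using \<gamma> by simp
  qed
  finally have embed2: "(\<integral>x. (embed x)\<^sup>2 \<partial>?P) = (\<gamma> ^ 4 / ((1 + \<gamma>\<^sup>2) * (3 + \<gamma>\<^sup>2))) powr ?d" .
  \<comment> \<open>Squaring doubles the exponent to an integer; positivity of the base permits the
    passage from \<open>powr\<close> to an ordinary power.\<close>
  have total2: "total\<^sup>2 = (\<gamma>\<^sup>2 / (2 + \<gamma>\<^sup>2)) ^ CARD('d)"
  proof -
    have "total\<^sup>2 = (\<gamma>\<^sup>2 / (2 + \<gamma>\<^sup>2)) powr real CARD('d)"
      by (simp add: total_eq power2_eq_square powr_add[symmetric])
    moreover have "\<gamma>\<^sup>2 / (2 + \<gamma>\<^sup>2) > 0"
      using \<gamma> by (intro divide_pos_pos add_pos_pos) auto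
    ultimately show ?thesis by (simp add: powr_realpow)
  qed
  have mmd: "mmd_u_sq \<gamma> ?P n z
      = total - 2 / real n * (\<Sum>i\<in>{1..n}. embed (z i))
        + 1 / (real n * (real n - 1)) * (\<Sum>i\<in>{1..n}. \<Sum>j\<in>{1..n} - {i}. rbf_kernel \<gamma> (z i) (z j))" for z
    by (simp add: mmd_u_sq_def total_def embed_def)
  have formula: "mmd_u_sq \<gamma> ?P n z
      = (\<gamma>\<^sup>2 / (2 + \<gamma>\<^sup>2)) powr ?d
        - 2 / real n * (\<gamma>\<^sup>2 / (1 + \<gamma>\<^sup>2)) powr ?d * (\<Sum>i\<in>{1..n}. exp (- (norm (z i))\<^sup>2 / (2 * (1 + \<gamma>\<^sup>2))))
        + 1 / (real n * (real n - 1)) * (\<Sum>i\<in>{1..n}. \<Sum>j\<in>{1..n} - {i}. exp (- (norm (z i - z j))\<^sup>2 / (2 * \<gamma>\<^sup>2)))" for z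
    unfolding mmd total_eq embed_eq by (simp add: rbf_kernel_def sum_distrib_left[symmetric])
  have variance: "prob_space.variance M (\<lambda>\<omega>. mmd_u_sq \<gamma> ?P n (\<lambda>i. Z i \<omega>)) =
      2 / (real n * (real n - 1)) *
        ((\<gamma>\<^sup>2 / (2 + \<gamma>\<^sup>2)) ^ CARD('d) + (\<gamma>\<^sup>2 / (4 + \<gamma>\<^sup>2)) powr ?d
         - 2 * (\<gamma> ^ 4 / ((1 + \<gamma>\<^sup>2) * (3 + \<gamma>\<^sup>2))) powr ?d)"
    if M: "prob_space M" and indep: "prob_space.indep_vars M (\<lambda>_. borel) Z {1..n}"
      and dist: "\<forall>i\<in>{1..n}. distr M borel (Z i) = ?P"
    for M :: "'w measure" and Z :: "nat \<Rightarrow> 'w \<Rightarrow> real ^ 'd"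
  proof -
    let ?c = "1 / (real n * (real n - 1))"
    let ?U = "\<lambda>\<omega>. \<Sum>i\<in>{1..n}. \<Sum>j\<in>{1..n} - {i}. centered (Z i \<omega>) (Z j \<omega>)"
    let ?B = "\<integral>(x, y). (centered x y)\<^sup>2 \<partial>(?P \<Otimes>\<^sub>M ?P)"
    have "mmd_u_sq \<gamma> ?P n (\<lambda>i. Z i \<omega>) = ?c * ?U \<omega>" for \<omega>
      unfolding mmd using U_statistic_centered[of "{1..n}" "real n" "\<lambda>i. Z i \<omega>"] assms by simp
    \<comment> \<open>Constants leave the Bochner integral unconditionally, so no integrability of
      \<open>?U\<close> has to be shown here.\<close>
    then have "prob_space.variance M (\<lambda>\<omega>. mmd_u_sq \<gamma> ?P n (\<lambda>i. Z i \<omega>))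
        = ?c\<^sup>2 * prob_space.variance M ?U"
      by (simp only: integral_mult_right_zero right_diff_distrib[symmetric] power_mult_distrib)
    also have "prob_space.variance M ?U = 2 * real (n * (n - 1)) * ?B"
      using c.variance_degenerate_U_statistic[OF integral_centered _ _ M indep] dist assms by simp
    \<comment> \<open>The \<open>n - 1\<close> on the left is natural-number subtraction;
      \<open>n \<ge> 2\<close> identifies it with \<open>real n - 1\<close> and makes the
      cancellation legitimate.\<close>
    also have "?c\<^sup>2 * (2 * real (n * (n - 1)) * ?B) = 2 * ?c * ?B"
      using assms by (simp add: of_nat_diff power2_eq_square)
    also have "?B = (\<gamma>\<^sup>2 / (2 + \<gamma>\<^sup>2)) ^ CARD('d) + (\<gamma>\<^sup>2 / (4 + \<gamma>\<^sup>2)) powr ?d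
         - 2 * (\<gamma> ^ 4 / ((1 + \<gamma>\<^sup>2) * (3 + \<gamma>\<^sup>2))) powr ?d"
      by (simp add: integral_centered_square k2 embed2 total2)
    finally show ?thesis by simp
  qed
  show ?thesis
    by (intro conjI allI impI formula variance)
qed

end
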